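(* Let $g(z)=b_0(z)+\mathop{\mathrm{K}}_{i=1}^{\infty}\left(\frac{c_i(z)}{b_i(z)}\right)$ be a continued fraction whose partial numerators $c_i(z)$ and partial denominators $b_i(z)$ are complex polynomials in $z$ of degree at most $\ell$, and let its $n$-th approximant $g_n(z)$ be the inverse of the rational function $r(z)=g_n(z)^{-1}$. Let $A\in\mathbb{C}^{m\times m}$, let $T_n(A)\in\mathbb{C}^{(n+1)m\times(n+1)m}$ be the CF-matrix constructed from $g_n$, and assume $T_n(A)$ is nonsingular. Then for every $v\in\mathbb{C}^m$, $$r(A)v = (e_1^{\mathsf{T}}\otimes I)\,T_n(A)^{-1}(e_1\otimes v),$$ i.e., the action of the rational matrix function $r(A)$ on the vector $v$ can be computed by solving a single linear system with the CF-matrix $T_n(A)$.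
   Context: $e_1\in\mathbb{C}^{n+1}$ is the first unit vector, $I$ is the $m\times m$ identity, $\otimes$ is the Kronecker product. Approximant: $g_n(z)=b_0(z)+\cfrac{c_1(z)}{b_1(z)+\cdots+\cfrac{c_n(z)}{b_n(z)}}$, understood as the rational function $g_n=p_n/q_n$, where $p_{-1}=1,\ q_{-1}=0,\ p_0=b_0,\ q_0=1$, $p_k=b_kp_{k-1}+c_kp_{k-2}$, $q_k=b_kq_{k-1}+c_kq_{k-2}$ for $k\ge1$. (Standing assumption: the $c_i$ are nonzero polynomials for $i=1,\dots,n$.) Thus $r=q_n/p_n$, and $r(A)$ is the usual matrix function of the rational function $r$. CF-matrix: choose polynomials $\alpha_i(z)=\sum_{j=0}^\ell\alpha_i^{(j)}z^j$, $\gamma_i(z)=\sum_{j=0}^\ell\gamma_i^{(j)}z^j$ ($i=1,\dots,n$) and $\beta_i(z)=\sum_{j=0}^\ell\beta_i^{(j)}z^j$ ($i=0,\dots,n$) with $\beta_i(z)=b_i(z)$ and $-\alpha_i(z)\gamma_i(z)=c_i(z)$ as polynomials. For each $j$ let $T_n^{(j)}\in\mathbb{C}^{(n+1)\times(n+1)}$ be the tridiagonal matrix with diagonal $\beta_0^{(j)},\dots,\beta_n^{(j)}$, subdiagonal $\alpha_1^{(j)},\dots,\alpha_n^{(j)}$ and superdiagonal $\gamma_1^{(j)},\dots,\gamma_n^{(j)}$. The CF-matrix is $$T_n(A)=\sum_{j=0}^{\ell}T_n^{(j)}\otimes A^j,$$ i.e. the block tridiagonal matrix with diagonal blocks $\beta_i(A)$,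 subdiagonal blocks $\alpha_i(A)$ and superdiagonal blocks $\gamma_i(A)$. *)

theory Defs
  imports
    "HOL-Computational_Algebra.Field_as_Ring"
    "HOL-Computational_Algebra.Polynomial_Factorial"
    "HOL-Computational_Algebra.Normalized_Fraction"
    "Jordan_Normal_Form.Gauss_Jordan_Elimination"
begin

text \<open>
  Approximants of \<open>b 0 + K (c i / b i)\<close>.  The three-term recurrences start at index \<open>-1\<close>, so all
  indices are shifted by one: \<open>cf_num b c k\<close> is $p_{k-1}$ and \<open>cf_den b c k\<close> is $q_{k-1}$.
\<close>

fun cf_num :: "(nat \<Rightarrow> 'a::comm_ring_1) \<Rightarrow> (nat \<Rightarrow> 'a) \<Rightarrow> nat \<Rightarrow> 'a" where
  "cf_num b c 0 = 1"
| "cf_num b c (Suc 0) = b 0"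
| "cf_num b c (Suc (Suc k)) = b (Suc k) * cf_num b c (Suc k) + c (Suc k) * cf_num b c k"

fun cf_den :: "(nat \<Rightarrow> 'a::comm_ring_1) \<Rightarrow> (nat \<Rightarrow> 'a) \<Rightarrow> nat \<Rightarrow> 'a" where
  "cf_den b c 0 = 0"
| "cf_den b c (Suc 0) = 1"
| "cf_den b c (Suc (Suc k)) = b (Suc k) * cf_den b c (Suc k) + c (Suc k) * cf_den b c k"

text \<open>
  If $q_n = 0$, the approximant (mathematically $\infty$) is \<open>0\<close> here; its \<open>inverse\<close> is then also
  \<open>0\<close>, which is the correct value of $q_n / p_n$.
\<close>

definition cf_approximant ::
    "(nat \<Rightarrow> complex poly) \<Rightarrow> (nat \<Rightarrow> complex poly) \<Rightarrow> nat \<Rightarrow> complex poly fract" where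
  "cf_approximant b c n = Fract (cf_num b c (Suc n)) (cf_den b c (Suc n))"

definition matsum :: "nat \<Rightarrow> nat \<Rightarrow> ('i \<Rightarrow> 'a::comm_monoid_add mat) \<Rightarrow> 'i set \<Rightarrow> 'a mat" where
  "matsum nr nc F J = mat nr nc (\<lambda>(i, k). \<Sum>j\<in>J. F j $$ (i, k))"

text \<open>Meaningful only for invertible matrices.\<close>

definition mat_inv :: "'a::field mat \<Rightarrow> 'a mat" where
  "mat_inv A = the (mat_inverse A)"

definition poly_mat :: "'a::comm_ring_1 poly \<Rightarrow> 'a mat \<Rightarrow> 'a mat" where
  "poly_mat p A =
     matsum (dim_row A) (dim_row A) (\<lambda>j. coeff p j \<cdot>\<^sub>m (A ^\<^sub>m j)) {..degree p}"

text \<open>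
  The matrix function of a rational function.  \<^const>\<open>quot_of_fract\<close> yields the representation in
  lowest terms, so \<open>ratfun_mat_defined r A\<close> says that no pole of \<open>r\<close> is an eigenvalue of \<open>A\<close>;
  \<open>ratfun_mat r A\<close> is meaningful only in that case.
\<close>

definition ratfun_mat_defined :: "complex poly fract \<Rightarrow> complex mat \<Rightarrow> bool" where
  "ratfun_mat_defined r A \<longleftrightarrow> invertible_mat (poly_mat (snd (quot_of_fract r)) A)"

definition ratfun_mat :: "complex poly fract \<Rightarrow> complex mat \<Rightarrow> complex mat" where
  "ratfun_mat r A =
     poly_mat (fst (quot_of_fract r)) A * mat_inv (poly_mat (snd (quot_of_fract r)) A)"

definition kron :: "'a::times mat \<Rightarrow> 'a mat \<Rightarrow> 'a mat" where
  "kron A B = mat (dim_row A * dim_row B) (dim_col A * dim_col B)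
     (\<lambda>(i, k). A $$ (i div dim_row B, k div dim_col B) * B $$ (i mod dim_row B, k mod dim_col B))"

definition kron_vec :: "'a::times vec \<Rightarrow> 'a vec \<Rightarrow> 'a vec" where
  "kron_vec u v = vec (dim_vec u * dim_vec v) (\<lambda>i. u $ (i div dim_vec v) * v $ (i mod dim_vec v))"

text \<open>
  Rows and columns are numbered from \<open>0\<close>: the subdiagonal entry \<open>lo i\<close> sits at position
  \<open>(i, i - 1)\<close> and the superdiagonal entry \<open>up i\<close> at \<open>(i - 1, i)\<close>, for \<open>1 \<le> i \<le> n\<close>.
\<close>

definition tridiag_mat ::
    "nat \<Rightarrow> (nat \<Rightarrow> 'a::zero) \<Rightarrow> (nat \<Rightarrow> 'a) \<Rightarrow> (nat \<Rightarrow> 'a) \<Rightarrow> 'a mat" where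
  "tridiag_mat n lo di up = mat (n + 1) (n + 1) (\<lambda>(i, k).
     if i = k then di i
     else if i = k + 1 then lo i
     else if k = i + 1 then up k
     else 0)"

definition cf_coeff_mat ::
    "nat \<Rightarrow> (nat \<Rightarrow> 'a::zero poly) \<Rightarrow> (nat \<Rightarrow> 'a poly) \<Rightarrow> (nat \<Rightarrow> 'a poly) \<Rightarrow> nat \<Rightarrow> 'a mat" where
  "cf_coeff_mat n \<alpha> \<beta> \<gamma> j =
     tridiag_mat n (\<lambda>i. coeff (\<alpha> i) j) (\<lambda>i. coeff (\<beta> i) j) (\<lambda>i. coeff (\<gamma> i) j)"

definition cf_matrix ::
    "nat \<Rightarrow> nat \<Rightarrow> (nat \<Rightarrow> 'a::comm_ring_1 poly) \<Rightarrow> (nat \<Rightarrow> 'a poly) \<Rightarrow> (nat \<Rightarrow> 'a poly) \<Rightarrow>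
      'a mat \<Rightarrow> 'a mat" where
  "cf_matrix l n \<alpha> \<beta> \<gamma> A =
     matsum ((n + 1) * dim_row A) ((n + 1) * dim_row A)
       (\<lambda>j. kron (cf_coeff_mat n \<alpha> \<beta> \<gamma> j) (A ^\<^sub>m j)) {..l}"

end

theory Submission
  imports Defs "Jordan_Normal_Form.Spectral_Radius"
begin

text \<open>
  The CF-matrix is the value at \<open>A\<close> of the tridiagonal matrix \<open>P\<close> over the polynomial ring with
  diagonal \<open>\<beta>\<close> and off-diagonals \<open>\<alpha>\<close>, \<open>\<gamma>\<close> (\<open>cf_matrix_eq_block_eval\<close>). All its blocks are polynomials
  in the one matrix \<open>A\<close>, so polynomial identities about \<open>P\<close> pass to the CF-matrix: if \<open>x\<close> is a
  polynomial vector, then the CF-matrix sends the block vector with blocks \<open>x\<^sub>k(A) u\<close> to the block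
  vector with blocks \<open>(P x)\<^sub>i(A) u\<close> (\<open>block_eval_mult_stack\<close>). This is used for two choices of \<open>x\<close>.

  For the formula, take the first column of the adjugate of \<open>P\<close>. The determinant of a tridiagonal
  matrix satisfies the three-term recurrence of the numerators, so \<open>det P = p\<^sub>n\<close>, and deleting the first
  row and column leaves a tridiagonal matrix of determinant \<open>q\<^sub>n\<close>. Hence \<open>P x = p\<^sub>n e\<^sub>1\<close> and
  \<open>x\<^sub>0 = q\<^sub>n\<close> (\<open>tridiag_adjugate_column\<close>). With \<open>u = p\<^sub>n(A)\<^sup>-\<^sup>1 v\<close> the stacked vector solves the linear system
  for the right-hand side \<open>e\<^sub>1 \<otimes> v\<close>, and its first block is \<open>q\<^sub>n(A) p\<^sub>n(A)\<^sup>-\<^sup>1 v = r(A) v\<close>.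

  It remains to see that \<open>p\<^sub>n(A)\<close> is invertible (\<open>block_eval_invertible_imp_det_injective\<close>). If not,
  \<open>A\<close> has an eigenvector \<open>u\<close> whose eigenvalue \<open>\<mu>\<close> is a root of \<open>p\<^sub>n = det P\<close>. Then \<open>P(\<mu>)\<close> has a nonzero
  null vector, and taking its entries as constant polynomials for \<open>x\<close> gives a nonzero vector in the kernel of
  the CF-matrix. Since the reduced denominator of \<open>r\<close> divides \<open>p\<^sub>n\<close>, its value at \<open>A\<close> is invertible too, and
  the common factor cancels in \<open>r(A)\<close> (\<open>ratfun_mat_fract\<close>).
\<close>

section \<open>The action of polynomials in a matrix on vectors\<close>

lemma poly_mat_carrier:
  assumes "A \<in> carrier_mat m m"
  shows "poly_mat p A \<in> carrier_mat m m"
  using assms by (simp add: poly_mat_def matsum_def)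

lemma poly_mat_dim [simp]: "dim_row (poly_mat p A) = dim_row A" "dim_col (poly_mat p A) = dim_row A"
  by (simp_all add: poly_mat_def matsum_def)

lemma poly_mat_index:
  fixes A :: "'a::comm_ring_1 mat"
  assumes A: "A \<in> carrier_mat m m" and "degree p \<le> N" "i < m" "k < m"
  shows "poly_mat p A $$ (i, k) = (\<Sum>j\<le>N. coeff p j * (A ^\<^sub>m j) $$ (i, k))"
proof -
  have "poly_mat p A $$ (i, k) = (\<Sum>j\<le>degree p. coeff p j * (A ^\<^sub>m j) $$ (i, k))"
    using assms by (auto simp: poly_mat_def matsum_def intro!: sum.cong)
  also have "\<dots> = (\<Sum>j\<le>N. coeff p j * (A ^\<^sub>m j) $$ (i, k))"
    using assms by (intro sum.mono_neutral_left) (auto intro: le_degree)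
  finally show ?thesis .
qed

lemma poly_mat_pCons:
  fixes A :: "'a::comm_ring_1 mat"
  assumes A: "A \<in> carrier_mat m m"
  shows "poly_mat (pCons a p) A = a \<cdot>\<^sub>m 1\<^sub>m m + poly_mat p A * A"
proof (rule eq_matI)
  note C = poly_mat_carrier[OF A]
  fix i k assume "i < dim_row (a \<cdot>\<^sub>m 1\<^sub>m m + poly_mat p A * A)"
    and "k < dim_col (a \<cdot>\<^sub>m 1\<^sub>m m + poly_mat p A * A)"
  hence ik: "i < m" "k < m" using A by auto
  have "degree (pCons a p) \<le> Suc (degree p)" by (rule degree_pCons_le)
  hence "poly_mat (pCons a p) A $$ (i, k)
      = a * (A ^\<^sub>m 0) $$ (i, k) + (\<Sum>j\<le>degree p. coeff p j * (A ^\<^sub>m (Suc j)) $$ (i, k))"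
    using poly_mat_index[OF A _ ik, of "pCons a p" "Suc (degree p)"]
    by (simp add: sum.atMost_Suc_shift del: sum.atMost_Suc pow_mat.simps)
  also have "(\<Sum>j\<le>degree p. coeff p j * (A ^\<^sub>m (Suc j)) $$ (i, k))
      = (\<Sum>j\<le>degree p. \<Sum>s<m. coeff p j * (A ^\<^sub>m j) $$ (i, s) * A $$ (s, k))"
    using A ik
    by (intro sum.cong refl)
       (simp add: scalar_prod_def sum_distrib_left mult.assoc atLeast0LessThan)
  also have "\<dots> = (\<Sum>s<m. poly_mat p A $$ (i, s) * A $$ (s, k))"
    unfolding sum.swap[of _ "{..<m}"] sum_distrib_right[symmetric]
    using poly_mat_index[OF A order_refl ik(1)] by simp
  also have "\<dots> = (poly_mat p A * A) $$ (i, k)"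
    using A C[of p] ik by (simp add: scalar_prod_def atLeast0LessThan)
  finally show "poly_mat (pCons a p) A $$ (i, k) = (a \<cdot>\<^sub>m 1\<^sub>m m + poly_mat p A * A) $$ (i, k)"
    using A C[of p] ik by simp
qed (use A in \<open>auto simp: poly_mat_def matsum_def\<close>)

lemma smult_zero_left_vec:
  fixes u :: "'a::comm_ring_1 vec"
  assumes "u \<in> carrier_vec m"
  shows "0 \<cdot>\<^sub>v u = 0\<^sub>v m"
  using assms by (intro eq_vecI) auto

lemma smult_zero_right_vec: "a \<cdot>\<^sub>v 0\<^sub>v m = (0\<^sub>v m :: 'a::comm_ring_1 vec)"
  by (intro eq_vecI) auto

lemma mult_mat_zero_vec:
  fixes A :: "'a::comm_ring_1 mat"
  assumes "A \<in> carrier_mat r m"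
  shows "A *\<^sub>v 0\<^sub>v m = 0\<^sub>v r"
  using assms by (intro eq_vecI) auto

lemma mult_mat_smult_vec:
  fixes A :: "'a::comm_ring_1 mat"
  assumes "A \<in> carrier_mat r m" "u \<in> carrier_vec m"
  shows "A *\<^sub>v (a \<cdot>\<^sub>v u) = a \<cdot>\<^sub>v (A *\<^sub>v u)"
  using assms by (intro eq_vecI) (simp_all add: scalar_prod_smult_distrib[of _ m])

lemma mult_mat_vec_index_sum:
  fixes A :: "'a::comm_ring_1 mat"
  assumes "A \<in> carrier_mat r m" "u \<in> carrier_vec m" "i < r"
  shows "(A *\<^sub>v u) $ i = (\<Sum>s<m. A $$ (i, s) * u $ s)"
  using assms by (simp add: scalar_prod_def atLeast0LessThan)

lemma poly_mat_zero_vec: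
  fixes A :: "'a::comm_ring_1 mat"
  assumes "A \<in> carrier_mat m m" "u \<in> carrier_vec m"
  shows "poly_mat 0 A *\<^sub>v u = 0\<^sub>v m"
proof -
  have "poly_mat 0 A = 0\<^sub>m m m"
    using assms by (intro eq_matI) (auto simp: poly_mat_def matsum_def)
  thus ?thesis using assms by (intro eq_vecI) auto
qed

text \<open>
  Through \<open>A\<close>, the vectors form a module over the polynomial ring. Horner's rule in this form, with
  \<open>A\<close> applied to the vector first, is what makes the inductions over polynomials below work with
  the vector generalized.
\<close>

lemma poly_mat_pCons_vec:
  fixes A :: "'a::comm_ring_1 mat"
  assumes A: "A \<in> carrier_mat m m" and u: "u \<in> carrier_vec m"
  shows "poly_mat (pCons a p) A *\<^sub>v u = a \<cdot>\<^sub>v u + poly_mat p A *\<^sub>v (A *\<^sub>v u)"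
proof -
  note C = poly_mat_carrier[OF A, of p]
  have "poly_mat (pCons a p) A *\<^sub>v u = (a \<cdot>\<^sub>m 1\<^sub>m m) *\<^sub>v u + (poly_mat p A * A) *\<^sub>v u"
    unfolding poly_mat_pCons[OF A] by (rule add_mult_distrib_mat_vec[OF _ mult_carrier_mat[OF C A] u]) simp
  also have "(a \<cdot>\<^sub>m 1\<^sub>m m) *\<^sub>v u = a \<cdot>\<^sub>v u"
    using u by (intro eq_vecI) (simp_all add: smult_scalar_prod_distrib[of _ m])
  also have "(poly_mat p A * A) *\<^sub>v u = poly_mat p A *\<^sub>v (A *\<^sub>v u)"
    by (rule assoc_mult_mat_vec[OF C A u])
  finally show ?thesis .
qed

lemma poly_mat_vec_carrier:
  assumes "A \<in> carrier_mat m m" "u \<in> carrier_vec m"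
  shows "poly_mat p A *\<^sub>v u \<in> carrier_vec m"
  using poly_mat_carrier[OF assms(1)] assms(2) by (rule mult_mat_vec_carrier)

lemma poly_mat_const_vec:
  fixes A :: "'a::comm_ring_1 mat"
  assumes A: "A \<in> carrier_mat m m" and u: "u \<in> carrier_vec m"
  shows "poly_mat [:a:] A *\<^sub>v u = a \<cdot>\<^sub>v u"
  using u A by (simp add: poly_mat_pCons_vec[OF A u] poly_mat_zero_vec[OF A])

lemma poly_mat_add_vec:
  fixes A :: "'a::comm_ring_1 mat"
  assumes A: "A \<in> carrier_mat m m" and u: "u \<in> carrier_vec m"
  shows "poly_mat (p + q) A *\<^sub>v u = poly_mat p A *\<^sub>v u + poly_mat q A *\<^sub>v u"
  using u
proof (induction p q arbitrary: u rule: poly_induct2)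
  case 0
  thus ?case using A by (simp add: poly_mat_zero_vec)
next
  case (pCons a p b q)
  have Au: "A *\<^sub>v u \<in> carrier_vec m" using A pCons by auto
  note C = poly_mat_vec_carrier[OF A Au]
  show ?case
    using pCons.IH[OF Au] C[of p] C[of q] pCons.prems A
    by (intro eq_vecI) (auto simp: poly_mat_pCons_vec[OF A] algebra_simps)
qed

lemma poly_mat_smult_vec:
  fixes A :: "'a::comm_ring_1 mat"
  assumes A: "A \<in> carrier_mat m m" and u: "u \<in> carrier_vec m"
  shows "poly_mat (Polynomial.smult a p) A *\<^sub>v u = a \<cdot>\<^sub>v (poly_mat p A *\<^sub>v u)"
  using u
proof (induction p arbitrary: u)
  case 0
  thus ?case using A by (simp add: poly_mat_zero_vec smult_zero_right_vec)
next
  case (pCons b p)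
  have Au: "A *\<^sub>v u \<in> carrier_vec m" using A pCons by auto
  note C = poly_mat_vec_carrier[OF A Au]
  show ?case
    using pCons.IH[OF Au] C[of p] pCons.prems A
    by (intro eq_vecI) (auto simp: poly_mat_pCons_vec[OF A] algebra_simps)
qed

lemma poly_mat_commute_vec:
  fixes A :: "'a::comm_ring_1 mat"
  assumes A: "A \<in> carrier_mat m m" and u: "u \<in> carrier_vec m"
  shows "poly_mat p A *\<^sub>v (A *\<^sub>v u) = A *\<^sub>v (poly_mat p A *\<^sub>v u)"
  using u
proof (induction p arbitrary: u)
  case 0
  hence "A *\<^sub>v u \<in> carrier_vec m" using A by auto
  thus ?case using A 0 by (simp add: poly_mat_zero_vec mult_mat_zero_vec)
next
  case (pCons b p)
  have Au: "A *\<^sub>v u \<in> carrier_vec m" using A pCons by auto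
  note C = poly_mat_vec_carrier[OF A Au]
  show ?case
    using pCons.IH[OF Au] C[of p] pCons.prems Au A
    by (simp add: poly_mat_pCons_vec[OF A] mult_add_distrib_mat_vec[OF A] mult_mat_smult_vec[OF A])
qed

lemma poly_mat_mult_vec:
  fixes A :: "'a::comm_ring_1 mat"
  assumes A: "A \<in> carrier_mat m m" and u: "u \<in> carrier_vec m"
  shows "poly_mat (p * q) A *\<^sub>v u = poly_mat p A *\<^sub>v (poly_mat q A *\<^sub>v u)"
  using u
proof (induction p arbitrary: u)
  case 0
  thus ?case using A by (simp add: poly_mat_zero_vec poly_mat_vec_carrier)
next
  case (pCons a p)
  have Au: "A *\<^sub>v u \<in> carrier_vec m" using A pCons by auto
  have "poly_mat (pCons a p * q) A *\<^sub>v u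
      = a \<cdot>\<^sub>v (poly_mat q A *\<^sub>v u) + (0 \<cdot>\<^sub>v u + poly_mat (p * q) A *\<^sub>v (A *\<^sub>v u))"
    using pCons.prems A by (simp add: poly_mat_add_vec poly_mat_smult_vec poly_mat_pCons_vec)
  also have "\<dots> = a \<cdot>\<^sub>v (poly_mat q A *\<^sub>v u) + poly_mat (p * q) A *\<^sub>v (A *\<^sub>v u)"
    using pCons.prems poly_mat_vec_carrier[OF A Au, of "p * q"] by (simp add: smult_zero_left_vec)
  also have "\<dots> = a \<cdot>\<^sub>v (poly_mat q A *\<^sub>v u) + poly_mat p A *\<^sub>v (A *\<^sub>v (poly_mat q A *\<^sub>v u))"
    using pCons.IH[OF Au] poly_mat_commute_vec[OF A pCons.prems] by simp
  also have "\<dots> = poly_mat (pCons a p) A *\<^sub>v (poly_mat q A *\<^sub>v u)"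
    using poly_mat_pCons_vec[OF A poly_mat_vec_carrier[OF A pCons.prems]] by simp
  finally show ?case .
qed

lemma poly_mat_eigenvector:
  fixes A :: "'a::comm_ring_1 mat"
  assumes A: "A \<in> carrier_mat m m" and u: "u \<in> carrier_vec m" and ev: "A *\<^sub>v u = \<mu> \<cdot>\<^sub>v u"
  shows "poly_mat p A *\<^sub>v u = poly p \<mu> \<cdot>\<^sub>v u"
proof (induction p)
  case 0
  thus ?case using A u by (simp add: poly_mat_zero_vec smult_zero_left_vec)
next
  case (pCons a p)
  have "poly_mat (pCons a p) A *\<^sub>v u = a \<cdot>\<^sub>v u + \<mu> \<cdot>\<^sub>v (poly_mat p A *\<^sub>v u)"
    using mult_mat_smult_vec[OF poly_mat_carrier[OF A] u] by (simp add: poly_mat_pCons_vec[OF A u] ev)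
  thus ?case using pCons u by (intro eq_vecI) (auto simp: algebra_simps)
qed

lemma poly_mat_sum_vec_index:
  fixes A :: "'a::comm_ring_1 mat"
  assumes A: "A \<in> carrier_mat m m" and u: "u \<in> carrier_vec m" and i: "i < m"
  shows "(poly_mat (\<Sum>k\<in>K. f k) A *\<^sub>v u) $ i = (\<Sum>k\<in>K. (poly_mat (f k) A *\<^sub>v u) $ i)"
proof (induction K rule: infinite_finite_induct)
  case (insert x F)
  thus ?case
    using carrier_vecD[OF poly_mat_vec_carrier[OF A u]] i
    by (simp add: poly_mat_add_vec[OF A u] del: dim_mult_mat_vec index_mult_mat_vec)
qed (use poly_mat_zero_vec[OF A u] i in auto)

text \<open>
  One half of the spectral mapping theorem. If the linear factors of \<open>p\<close> are applied to \<open>w\<close> one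
  after the other, one of them must be the first to turn a nonzero vector into \<open>0\<close>, and that vector
  is an eigenvector. For \<open>p = 0\<close> any eigenvalue will do.
\<close>

lemma poly_mat_kernel_imp_eigenvector:
  fixes A :: "complex mat"
  assumes A: "A \<in> carrier_mat m m" and w: "w \<in> carrier_vec m" "w \<noteq> 0\<^sub>v m"
    and pw: "poly_mat p A *\<^sub>v w = 0\<^sub>v m"
  obtains \<mu> u where "u \<in> carrier_vec m" "u \<noteq> 0\<^sub>v m" "A *\<^sub>v u = \<mu> \<cdot>\<^sub>v u" "poly p \<mu> = 0"
proof (cases "p = 0")
  case True
  have "m > 0" using w by (cases m) auto
  hence "spectrum A \<noteq> {}" using spectrum_non_empty[OF A] by simp
  then obtain \<mu> where "eigenvalue A \<mu>" by (auto simp: spectrum_def)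
  then obtain u where "eigenvector A u \<mu>" by (auto simp: eigenvalue_def)
  with A True show ?thesis by (intro that[of u \<mu>]) (auto simp: eigenvector_def)
next
  case False
  from False pw have "\<exists>\<mu> u. u \<in> carrier_vec m \<and> u \<noteq> 0\<^sub>v m \<and> A *\<^sub>v u = \<mu> \<cdot>\<^sub>v u \<and> poly p \<mu> = 0"
  proof (induction "degree p" arbitrary: p)
    case 0
    then obtain a where p: "p = [:a:]" by (auto elim: degree_eq_zeroE)
    with 0 have a: "a \<noteq> 0" by auto
    have "a \<cdot>\<^sub>v w = 0\<^sub>v m" using 0 p poly_mat_const_vec[OF A w(1)] by simp
    hence "w = 0\<^sub>v m"
      using w(1) a by (auto simp: vec_eq_iff)
    with w(2) show ?case by simp
  next
    case (Suc d)
    hence "\<not> constant (poly p)" by (simp add: constant_degree)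
    then obtain \<mu> where \<mu>: "poly p \<mu> = 0" using fundamental_theorem_of_algebra by blast
    then obtain q where q: "p = [:- \<mu>, 1:] * q" by (auto simp: poly_eq_0_iff_dvd dvd_def)
    from q Suc have q0: "q \<noteq> 0" by auto
    have "degree p = 1 + degree q" unfolding q by (subst degree_mult_eq) (use q0 in auto)
    hence "degree q = d" using Suc(2) by simp
    define u where "u = poly_mat q A *\<^sub>v w"
    have u: "u \<in> carrier_vec m" unfolding u_def by (rule poly_mat_vec_carrier[OF A w(1)])
    show ?case
    proof (cases "u = 0\<^sub>v m")
      case True
      from Suc(1)[OF \<open>degree q = d\<close>[symmetric] q0] True q show ?thesis by (auto simp: u_def)
    next
      case False
      have Au: "A *\<^sub>v u \<in> carrier_vec m" using A u by auto
      have "poly_mat [:- \<mu>, 1:] A *\<^sub>v u = 0\<^sub>v m"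
        using Suc.prems poly_mat_mult_vec[OF A w(1), of "[:- \<mu>, 1:]" q] q unfolding u_def by metis
      moreover have "poly_mat [:- \<mu>, 1:] A *\<^sub>v u = (- \<mu>) \<cdot>\<^sub>v u + 1 \<cdot>\<^sub>v (A *\<^sub>v u)"
        using poly_mat_pCons_vec[OF A u] poly_mat_const_vec[OF A Au] by metis
      ultimately have *: "(- \<mu>) \<cdot>\<^sub>v u + 1 \<cdot>\<^sub>v (A *\<^sub>v u) = 0\<^sub>v m" by simp
      have "A *\<^sub>v u = \<mu> \<cdot>\<^sub>v u"
      proof (rule eq_vecI)
        fix i assume "i < dim_vec (\<mu> \<cdot>\<^sub>v u)"
        hence i: "i < m" using u by simp
        show "(A *\<^sub>v u) $ i = (\<mu> \<cdot>\<^sub>v u) $ i"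
          using arg_cong[OF *, of "\<lambda>x. x $ i"] i u A by simp
      qed (use u A in auto)
      with False \<mu> u show ?thesis by blast
    qed
  qed
  thus ?thesis using that by blast
qed

section \<open>Tridiagonal determinants and continuants\<close>

text \<open>
  Here the size may be \<open>0\<close>, which is the natural base case of the determinant recurrence and occurs when
  the first row and column of a matrix of size \<open>1\<close> are deleted.
\<close>

definition tridiag_square ::
    "nat \<Rightarrow> (nat \<Rightarrow> 'a::zero) \<Rightarrow> (nat \<Rightarrow> 'a) \<Rightarrow> (nat \<Rightarrow> 'a) \<Rightarrow> 'a mat" where
  "tridiag_square k lo di up = mat k k (\<lambda>(i, j).
     if i = j then di i else if i = j + 1 then lo i else if j = i + 1 then up j else 0)"

lemma tridiag_mat_conv_square: "tridiag_mat n lo di up = tridiag_square (Suc n) lo di up"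
  by (simp add: tridiag_mat_def tridiag_square_def)

lemma tridiag_square_carrier [simp]: "tridiag_square k lo di up \<in> carrier_mat k k"
  by (simp add: tridiag_square_def)

text \<open>
  Laplace expansion along the last row has two terms. The minor of the subdiagonal entry has
  a last column whose only nonzero entry is the superdiagonal one, so a second expansion reduces
  it to the leading block two sizes smaller.
\<close>

lemma det_tridiag_square:
  fixes lo di up :: "nat \<Rightarrow> 'a::comm_ring_1"
  shows "det (tridiag_square k lo di up) = cf_num di (\<lambda>i. - (lo i * up i)) k"
proof (induction di "\<lambda>i. - (lo i * up i)" k rule: cf_num.induct)
  case (1 di)
  show ?case by simp
next
  case (2 di)
  have "det (tridiag_square (Suc 0) lo di up) = tridiag_square (Suc 0) lo di up $$ (0, 0)"
    by (rule det_single) simp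
  thus ?case by (simp add: tridiag_square_def)
next
  case (3 di k)
  let ?T = "\<lambda>k. tridiag_square k lo di up"
  let ?M = "mat_delete (?T (Suc (Suc k))) (Suc k) k"
  have M: "?M \<in> carrier_mat (Suc k) (Suc k)"
    using mat_delete_carrier[OF tridiag_square_carrier, of "Suc (Suc k)" lo di up "Suc k" k] by simp
  have del1: "mat_delete (?T (Suc (Suc k))) (Suc k) (Suc k) = ?T (Suc k)"
    by (rule eq_matI) (auto simp: mat_delete_def tridiag_square_def)
  have del2: "mat_delete ?M k k = ?T k"
    by (rule eq_matI) (auto simp: mat_delete_def tridiag_square_def)
  have "det ?M = (\<Sum>i<Suc k. ?M $$ (i, k) * cofactor ?M i k)"
    by (rule laplace_expansion_column[OF M]) simp
  also have "\<dots> = ?M $$ (k, k) * cofactor ?M k k"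
    by (simp, rule sum.neutral) (auto simp: mat_delete_def tridiag_square_def)
  also have "\<dots> = up (Suc k) * det (?T k)"
    unfolding cofactor_def del2 by (simp add: mat_delete_def tridiag_square_def)
  finally have detM: "det ?M = up (Suc k) * det (?T k)" .
  have "det (?T (Suc (Suc k)))
      = (\<Sum>j<Suc (Suc k). ?T (Suc (Suc k)) $$ (Suc k, j) * cofactor (?T (Suc (Suc k))) (Suc k) j)"
    by (rule laplace_expansion_row) auto
  also have "\<dots> = ?T (Suc (Suc k)) $$ (Suc k, k) * cofactor (?T (Suc (Suc k))) (Suc k) k
      + ?T (Suc (Suc k)) $$ (Suc k, Suc k) * cofactor (?T (Suc (Suc k))) (Suc k) (Suc k)"
    by (simp, rule sum.neutral) (auto simp: tridiag_square_def)
  also have "\<dots> = di (Suc k) * det (?T (Suc k)) - lo (Suc k) * up (Suc k) * det (?T k)"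
    unfolding cofactor_def del1 detM by (simp add: tridiag_square_def power_add[symmetric])
  finally show ?case using 3 by simp
qed

text \<open>
  The denominators are the numerators of the continued fraction with its first level removed; this
  is what relates them to the minor at position \<open>(0, 0)\<close>.
\<close>

lemma cf_den_conv_cf_num:
  "cf_den b c (Suc k) = cf_num (\<lambda>i. b (Suc i)) (\<lambda>i. c (Suc i)) k"
  by (induction "\<lambda>i. b (Suc i)" "\<lambda>i. c (Suc i)" k rule: cf_num.induct) auto

lemma cf_num_cong:
  assumes "\<And>i. i < k \<Longrightarrow> b i = b' i" "\<And>i. 1 \<le> i \<Longrightarrow> i < k \<Longrightarrow> c i = c' i"
  shows "cf_num b c k = cf_num b' c' k"
  using assms by (induction b c k rule: cf_num.induct) auto

lemma cf_den_cong:
  assumes "\<And>i. i < k \<Longrightarrow> b i = b' i" "\<And>i. 1 \<le> i \<Longrightarrow> i < k \<Longrightarrow> c i = c' i"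
  shows "cf_den b c k = cf_den b' c' k"
  using assms by (induction b c k rule: cf_den.induct) auto

lemma det_tridiag_mat:
  fixes lo di up :: "nat \<Rightarrow> 'a::comm_ring_1"
  shows "det (tridiag_mat n lo di up) = cf_num di (\<lambda>i. - (lo i * up i)) (Suc n)"
  by (simp only: tridiag_mat_conv_square det_tridiag_square)

text \<open>
  The vector is the first column of the adjugate. For an invertible matrix this is Cramer's rule
  for \<open>e\<^sub>1\<close>, but with the denominators cleared it makes sense over every commutative ring, in
  particular over polynomials.
\<close>

lemma tridiag_adjugate_column:
  fixes lo di up :: "nat \<Rightarrow> 'a::comm_ring_1"
  obtains x where "x \<in> carrier_vec (Suc n)"
    "tridiag_mat n lo di up *\<^sub>v x
       = cf_num di (\<lambda>i. - (lo i * up i)) (Suc n) \<cdot>\<^sub>v unit_vec (Suc n) 0"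
    "x $ 0 = cf_den di (\<lambda>i. - (lo i * up i)) (Suc n)"
proof
  let ?T = "tridiag_mat n lo di up"
  let ?x = "col (adj_mat ?T) 0"
  have T: "?T \<in> carrier_mat (Suc n) (Suc n)" by (simp add: tridiag_mat_def)
  note adj = adj_mat[OF T]
  show "?x \<in> carrier_vec (Suc n)" using adj(1) by (metis carrier_matD(1) col_dim)
  have "?T *\<^sub>v ?x = col (?T * adj_mat ?T) 0"
    using adj(1) T by (simp add: col_mult2)
  also have "\<dots> = det ?T \<cdot>\<^sub>v unit_vec (Suc n) 0"
    unfolding adj(2) by (rule eq_vecI) auto
  finally show "?T *\<^sub>v ?x = cf_num di (\<lambda>i. - (lo i * up i)) (Suc n) \<cdot>\<^sub>v unit_vec (Suc n) 0"
    by (simp only: det_tridiag_mat)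
  have del: "mat_delete ?T 0 0
      = tridiag_square n (\<lambda>i. lo (Suc i)) (\<lambda>i. di (Suc i)) (\<lambda>i. up (Suc i))"
    by (rule eq_matI) (auto simp: mat_delete_def tridiag_mat_def tridiag_square_def)
  have "?x $ 0 = det (mat_delete ?T 0 0)"
    using T by (simp add: adj_mat_def cofactor_def)
  thus "?x $ 0 = cf_den di (\<lambda>i. - (lo i * up i)) (Suc n)"
    by (simp only: del det_tridiag_square cf_den_conv_cf_num)
qed

section \<open>Evaluation of polynomial matrices at a matrix\<close>

definition block_eval :: "'a::comm_ring_1 poly mat \<Rightarrow> 'a mat \<Rightarrow> 'a mat" where
  "block_eval P A = (let m = dim_row A in mat (dim_row P * m) (dim_col P * m)
     (\<lambda>(i, k). poly_mat (P $$ (i div m, k div m)) A $$ (i mod m, k mod m)))"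

definition stack :: "nat \<Rightarrow> nat \<Rightarrow> (nat \<Rightarrow> 'a vec) \<Rightarrow> 'a vec" where
  "stack N m X = vec (N * m) (\<lambda>i. X (i div m) $ (i mod m))"

lemma sum_blocks:
  fixes g :: "nat \<Rightarrow> nat \<Rightarrow> 'a::comm_monoid_add"
  assumes "m > 0"
  shows "(\<Sum>i<N * m. g (i div m) (i mod m)) = (\<Sum>k<N. \<Sum>s<m. g k s)"
proof -
  have "(\<Sum>i<N * m. g (i div m) (i mod m)) = (\<Sum>k<N. \<Sum>i=k*m..<k*m+m. g (i div m) (i mod m))"
    by (rule sum.nat_group[symmetric])
  also have "\<dots> = (\<Sum>k<N. \<Sum>s<m. g k s)"
  proof (rule sum.cong[OF refl])
    fix k
    have "(\<Sum>i=k*m..<k*m+m. g (i div m) (i mod m))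
        = (\<Sum>s=0..<m. g ((s + k*m) div m) ((s + k*m) mod m))"
      using sum.shift_bounds_nat_ivl[of "\<lambda>i. g (i div m) (i mod m)" 0 "k*m" m]
      by (simp add: add.commute)
    also have "\<dots> = (\<Sum>s<m. g k s)"
      using assms by (intro sum.cong) auto
    finally show "(\<Sum>i=k*m..<k*m+m. g (i div m) (i mod m)) = (\<Sum>s<m. g k s)" .
  qed
  finally show ?thesis .
qed

lemma block_index_less:
  fixes i N m :: nat
  assumes "i < N * m"
  shows "i div m < N" "i mod m < m" "m > 0"
proof -
  show "m > 0" using assms by (cases m) auto
  thus "i div m < N" "i mod m < m" using assms by (auto simp: less_mult_imp_div_less)
qed

text \<open>
  Block multiplication, combined with the rule that \<open>(f g)(A) u = f(A) (g(A) u)\<close>. All blocks of the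
  stacked vector come from the same \<open>u\<close>, so the sum over a block row is again the action of
  one polynomial on \<open>u\<close>.
\<close>

lemma block_eval_mult_stack:
  fixes A :: "'a::comm_ring_1 mat"
  assumes P: "P \<in> carrier_mat R N" and A: "A \<in> carrier_mat m m"
    and x: "x \<in> carrier_vec N" and u: "u \<in> carrier_vec m"
  shows "block_eval P A *\<^sub>v stack N m (\<lambda>k. poly_mat (x $ k) A *\<^sub>v u)
       = stack R m (\<lambda>i. poly_mat ((P *\<^sub>v x) $ i) A *\<^sub>v u)"
proof (rule eq_vecI)
  fix i assume "i < dim_vec (stack R m (\<lambda>i. poly_mat ((P *\<^sub>v x) $ i) A *\<^sub>v u))"
  hence i: "i < R * m" by (simp add: stack_def)
  note im = block_index_less[OF i]
  let ?X = "\<lambda>k. poly_mat (x $ k) A *\<^sub>v u"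
  let ?i = "i div m" and ?r = "i mod m"
  note C = poly_mat_carrier[OF A] and Cv = poly_mat_vec_carrier[OF A u]
  have "(block_eval P A *\<^sub>v stack N m ?X) $ i
      = (\<Sum>j<N * m. poly_mat (P $$ (?i, j div m)) A $$ (?r, j mod m) * ?X (j div m) $ (j mod m))"
    using i P A
    by (simp add: block_eval_def stack_def Let_def scalar_prod_def atLeast0LessThan)
  also have "\<dots> = (\<Sum>k<N. \<Sum>s<m. poly_mat (P $$ (?i, k)) A $$ (?r, s) * ?X k $ s)"
    using sum_blocks[OF im(3), of "\<lambda>k s. poly_mat (P $$ (?i, k)) A $$ (?r, s) * ?X k $ s"] .
  also have "\<dots> = (\<Sum>k<N. (poly_mat (P $$ (?i, k)) A *\<^sub>v ?X k) $ ?r)"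
    using mult_mat_vec_index_sum[OF C Cv im(2)] by simp
  also have "\<dots> = (\<Sum>k<N. (poly_mat (P $$ (?i, k) * x $ k) A *\<^sub>v u) $ ?r)"
    by (simp only: poly_mat_mult_vec[OF A u])
  also have "\<dots> = (poly_mat (\<Sum>k<N. P $$ (?i, k) * x $ k) A *\<^sub>v u) $ ?r"
    by (rule poly_mat_sum_vec_index[OF A u im(2), symmetric])
  also have "(\<Sum>k<N. P $$ (?i, k) * x $ k) = (P *\<^sub>v x) $ ?i"
    using P x im by (simp add: scalar_prod_def atLeast0LessThan)
  finally show "(block_eval P A *\<^sub>v stack N m ?X) $ i
      = stack R m (\<lambda>i. poly_mat ((P *\<^sub>v x) $ i) A *\<^sub>v u) $ i"
    using i by (simp add: stack_def)
qed (use P A in \<open>auto simp: block_eval_def stack_def Let_def\<close>)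

lemma block_eval_carrier:
  assumes "P \<in> carrier_mat R N" "A \<in> carrier_mat m m"
  shows "block_eval P A \<in> carrier_mat (R * m) (N * m)"
  using assms by (simp add: block_eval_def Let_def)

lemma cf_matrix_eq_block_eval:
  fixes A :: "'a::comm_ring_1 mat"
  assumes A: "A \<in> carrier_mat m m"
    and \<alpha>: "\<And>i. 1 \<le> i \<Longrightarrow> i \<le> n \<Longrightarrow> degree (\<alpha> i) \<le> l"
    and \<beta>: "\<And>i. i \<le> n \<Longrightarrow> degree (\<beta> i) \<le> l"
    and \<gamma>: "\<And>i. 1 \<le> i \<Longrightarrow> i \<le> n \<Longrightarrow> degree (\<gamma> i) \<le> l"
  shows "cf_matrix l n \<alpha> \<beta> \<gamma> A = block_eval (tridiag_mat n \<alpha> \<beta> \<gamma>) A"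
proof (rule eq_matI)
  let ?T = "tridiag_mat n \<alpha> \<beta> \<gamma>"
  fix i k assume "i < dim_row (block_eval ?T A)" "k < dim_col (block_eval ?T A)"
  hence ik: "i < (n + 1) * m" "k < (n + 1) * m"
    using A by (auto simp: block_eval_def Let_def tridiag_mat_def)
  note im = block_index_less[OF ik(1)] and km = block_index_less[OF ik(2)]
  have deg: "degree (?T $$ (i div m, k div m)) \<le> l"
    using im(1) km(1) \<alpha> \<beta> \<gamma> by (auto simp: tridiag_mat_def)
  have cf: "cf_coeff_mat n \<alpha> \<beta> \<gamma> j $$ (i div m, k div m) = coeff (?T $$ (i div m, k div m)) j" for j
    using im(1) km(1) by (auto simp: cf_coeff_mat_def tridiag_mat_def)
  have dims: "dim_row (cf_coeff_mat n \<alpha> \<beta> \<gamma> j) = n + 1"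
    "dim_col (cf_coeff_mat n \<alpha> \<beta> \<gamma> j) = n + 1" for j
    by (auto simp: cf_coeff_mat_def tridiag_mat_def)
  have pow: "dim_row (A ^\<^sub>m j) = m" "dim_col (A ^\<^sub>m j) = m" for j
    using pow_carrier_mat[OF A, of j] by auto
  have "cf_matrix l n \<alpha> \<beta> \<gamma> A $$ (i, k)
      = (\<Sum>j\<le>l. coeff (?T $$ (i div m, k div m)) j * (A ^\<^sub>m j) $$ (i mod m, k mod m))"
    using ik A by (simp add: cf_matrix_def matsum_def kron_def dims pow cf del: pow_mat_dim)
  also have "\<dots> = poly_mat (?T $$ (i div m, k div m)) A $$ (i mod m, k mod m)"
    by (rule poly_mat_index[OF A deg im(2) km(2), symmetric])
  also have "\<dots> = block_eval ?T A $$ (i, k)"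
    using ik A by (simp add: block_eval_def Let_def tridiag_mat_def)
  finally show "cf_matrix l n \<alpha> \<beta> \<gamma> A $$ (i, k) = block_eval ?T A $$ (i, k)" .
qed (use A in \<open>auto simp: cf_matrix_def matsum_def block_eval_def Let_def tridiag_mat_def\<close>)

lemma stack_eq_zeroD:
  assumes "stack N m X = 0\<^sub>v (N * m)" "k < N" "s < m"
  shows "X k $ s = 0"
proof -
  have "k * m + s < Suc k * m" using assms by simp
  also have "\<dots> \<le> N * m" using assms by (intro mult_right_mono) auto
  finally have ks: "k * m + s < N * m" .
  have "stack N m X $ (k * m + s) = X k $ s" using ks assms(2,3) by (simp add: stack_def)
  with assms(1) ks show ?thesis by simp
qed

section \<open>Inverse matrices\<close>

lemma invertible_mat_obtain:
  assumes T: "T \<in> carrier_mat k k" and "invertible_mat T"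
  obtains B where "B \<in> carrier_mat k k" "B * T = 1\<^sub>m k" "T * B = 1\<^sub>m k"
proof -
  from assms obtain B where B: "T * B = 1\<^sub>m (dim_row T)" "B * T = 1\<^sub>m (dim_row B)"
    by (auto simp: invertible_mat_def inverts_mat_def)
  from T B have "dim_col B = k" by (metis carrier_matD(1) index_mult_mat(3) index_one_mat(3))
  moreover from T B have "dim_row B = k" by (metis carrier_matD(2) index_mult_mat(3) index_one_mat(3))
  ultimately show ?thesis using B T by (intro that[of B]) auto
qed

lemma mat_inv_inverts:
  fixes T :: "'a::field mat"
  assumes T: "T \<in> carrier_mat k k" and inv: "invertible_mat T"
  shows "mat_inv T \<in> carrier_mat k k" "mat_inv T * T = 1\<^sub>m k" "T * mat_inv T = 1\<^sub>m k"
proof -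
  obtain B where B: "B \<in> carrier_mat k k" "B * T = 1\<^sub>m k" "T * B = 1\<^sub>m k"
    using invertible_mat_obtain[OF assms] .
  hence "T \<in> Units (ring_mat TYPE('a) k ())" using T by (auto simp: Units_def ring_mat_def)
  then obtain C where C: "mat_inverse T = Some C"
    using mat_inverse(1)[OF T, of "()"] by (cases "mat_inverse T") auto
  from mat_inverse(2)[OF T C] C
  show "mat_inv T \<in> carrier_mat k k" "mat_inv T * T = 1\<^sub>m k" "T * mat_inv T = 1\<^sub>m k"
    by (auto simp: mat_inv_def)
qed

lemma mat_inv_mult_vec:
  fixes T :: "'a::field mat"
  assumes T: "T \<in> carrier_mat k k" and inv: "invertible_mat T" and y: "y \<in> carrier_vec k"
  shows "mat_inv T *\<^sub>v (T *\<^sub>v y) = y"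
  using mat_inv_inverts[OF T inv] T y
  by (metis assoc_mult_mat_vec one_mult_mat_vec)

lemma invertible_mat_if_trivial_kernel:
  fixes T :: "'a::field mat"
  assumes T: "T \<in> carrier_mat k k"
    and ker: "\<And>w. w \<in> carrier_vec k \<Longrightarrow> T *\<^sub>v w = 0\<^sub>v k \<Longrightarrow> w = 0\<^sub>v k"
  shows "invertible_mat T"
proof -
  have "det T \<noteq> 0" using det_0_iff_vec_prod_zero[OF T] ker by blast
  hence "T \<in> Units (ring_mat TYPE('a) k ())" by (rule det_non_zero_imp_unit[OF T])
  then obtain B where "B \<in> carrier_mat k k" "B * T = 1\<^sub>m k" "T * B = 1\<^sub>m k"
    by (auto simp: Units_def ring_mat_def)
  with T show ?thesis by (auto simp: invertible_mat_def inverts_mat_def intro!: exI[of _ B])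
qed

section \<open>Injectivity of the determinant evaluated at a matrix\<close>

lemma comm_ring_hom_poly_eval: "comm_ring_hom (\<lambda>p. poly p (\<mu>::'a::comm_ring_1))"
  by unfold_locales auto

text \<open>
  If \<open>w\<close> were a nonzero vector in the kernel of \<open>(det P)(A)\<close>, then some eigenvalue \<open>\<mu>\<close> of \<open>A\<close>, with
  eigenvector \<open>u\<close>, would be a root of \<open>det P\<close>. A null vector \<open>x\<close> of the scalar matrix \<open>P(\<mu>)\<close> then yields
  the nonzero vector \<open>x \<otimes> u\<close> in the kernel of the evaluated block matrix, because every block
  acts on \<open>u\<close> as a scalar.
\<close>

lemma block_eval_invertible_imp_det_injective:
  fixes A :: "complex mat"
  assumes P: "P \<in> carrier_mat N N" and A: "A \<in> carrier_mat m m"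
    and inv: "invertible_mat (block_eval P A)"
    and w: "w \<in> carrier_vec m" "poly_mat (det P) A *\<^sub>v w = 0\<^sub>v m"
  shows "w = 0\<^sub>v m"
proof (rule ccontr)
  assume "w \<noteq> 0\<^sub>v m"
  then obtain \<mu> u where u: "u \<in> carrier_vec m" "u \<noteq> 0\<^sub>v m" "A *\<^sub>v u = \<mu> \<cdot>\<^sub>v u"
    and root: "poly (det P) \<mu> = 0"
    using poly_mat_kernel_imp_eigenvector[OF A w(1) _ w(2)] by metis
  let ?P = "map_mat (\<lambda>p. poly p \<mu>) P"
  have P': "?P \<in> carrier_mat N N" using P by simp
  have "det ?P = 0" using root by (simp only: comm_ring_hom.hom_det[OF comm_ring_hom_poly_eval])
  then obtain x where x: "x \<in> carrier_vec N" "x \<noteq> 0\<^sub>v N" "?P *\<^sub>v x = 0\<^sub>v N"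
    using det_0_iff_vec_prod_zero[OF P'] by blast
  \<comment> \<open>With constant polynomials as entries, the stacked vector is the Kronecker product of \<open>x\<close> and \<open>u\<close>.\<close>
  let ?x = "map_vec (\<lambda>a. [:a:]) x"
  let ?y = "stack N m (\<lambda>k. poly_mat (?x $ k) A *\<^sub>v u)"
  have y: "?y \<in> carrier_vec (N * m)" by (simp add: stack_def)
  have "block_eval P A *\<^sub>v ?y = stack N m (\<lambda>i. poly_mat ((P *\<^sub>v ?x) $ i) A *\<^sub>v u)"
    by (rule block_eval_mult_stack[OF P A _ u(1)]) (use x in simp)
  also have "\<dots> = 0\<^sub>v (N * m)"
  proof (rule eq_vecI)
    fix i assume "i < dim_vec (0\<^sub>v (N * m) :: complex vec)"
    hence i: "i < N * m" by simp
    note im = block_index_less[OF i]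
    have "poly ((P *\<^sub>v ?x) $ (i div m)) \<mu> = (?P *\<^sub>v x) $ (i div m)"
      using im P x(1) by (simp add: scalar_prod_def poly_sum mult.commute)
    also have "\<dots> = 0" using x(3) im by simp
    finally have "poly_mat ((P *\<^sub>v ?x) $ (i div m)) A *\<^sub>v u = 0\<^sub>v m"
      using poly_mat_eigenvector[OF A u(1,3)] smult_zero_left_vec[OF u(1)] by simp
    thus "stack N m (\<lambda>i. poly_mat ((P *\<^sub>v ?x) $ i) A *\<^sub>v u) $ i = 0\<^sub>v (N * m) $ i"
      using i im by (simp add: stack_def)
  qed (simp add: stack_def)
  finally have zero: "block_eval P A *\<^sub>v ?y = 0\<^sub>v (N * m)" .
  note T = block_eval_carrier[OF P A]
  have "?y = 0\<^sub>v (N * m)"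
    using mat_inv_mult_vec[OF T inv y] mult_mat_zero_vec[OF mat_inv_inverts(1)[OF T inv]] zero
    by simp
  hence ysx: "(poly_mat (?x $ k) A *\<^sub>v u) $ s = 0" if "k < N" "s < m" for k s
    using stack_eq_zeroD that by blast
  have xk: "x $ k * u $ s = 0" if "k < N" "s < m" for k s
    using ysx[OF that] that x(1) u(1) poly_mat_const_vec[OF A u(1)] by simp
  from x(1,2) obtain k where "k < N" "x $ k \<noteq> 0" by (metis carrier_vecD eq_vecI index_zero_vec)
  moreover from u(1,2) obtain s where "s < m" "u $ s \<noteq> 0" by (metis carrier_vecD eq_vecI index_zero_vec)
  ultimately show False using xk by (metis mult_eq_0_iff)
qed

section \<open>The first block of the solution\<close>

lemma kron_unit_row_mult_stack:
  fixes X :: "nat \<Rightarrow> 'a::comm_ring_1 vec"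
  assumes X: "X 0 \<in> carrier_vec m"
  shows "kron (mat_of_row (unit_vec (n + 1) 0)) (1\<^sub>m m) *\<^sub>v stack (n + 1) m X = X 0"
proof (rule eq_vecI)
  fix i assume "i < dim_vec (X 0)"
  hence i: "i < m" using X by simp
  hence m: "m > 0" by simp
  let ?e = "unit_vec (n + 1) 0 :: 'a vec"
  have "(kron (mat_of_row ?e) (1\<^sub>m m) *\<^sub>v stack (n + 1) m X) $ i
      = (\<Sum>j<(n + 1) * m. mat_of_row ?e $$ (0, j div m) * 1\<^sub>m m $$ (i, j mod m)
           * X (j div m) $ (j mod m))"
    using i by (simp add: kron_def stack_def scalar_prod_def atLeast0LessThan)
  also have "\<dots> = (\<Sum>k<n + 1. \<Sum>s<m. mat_of_row ?e $$ (0, k) * 1\<^sub>m m $$ (i, s) * X k $ s)"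
    by (rule sum_blocks[OF m])
  also have "\<dots> = (\<Sum>k<n + 1. \<Sum>s<m. if s = i then (if k = 0 then X k $ s else 0) else 0)"
    using i by (intro sum.cong refl) (auto simp: mat_of_row_index unit_vec_def)
  also have "\<dots> = X 0 $ i" using i by (simp add: sum.delta)
  finally show "(kron (mat_of_row ?e) (1\<^sub>m m) *\<^sub>v stack (n + 1) m X) $ i = X 0 $ i" .
qed (use X in \<open>auto simp: kron_def\<close>)

text \<open>
  The adjugate column \<open>x\<close> satisfies \<open>P x = p e\<^sub>1\<close>, so the blocks \<open>x\<^sub>k(A) u\<close> solve the system whose
  right-hand side has first block \<open>p(A) u\<close>. Its solution is thus free of divisions, and only its
  first block \<open>x\<^sub>0(A) u = q(A) u\<close> is read off.
\<close>

lemma block_system_solution: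
  fixes lo di up :: "nat \<Rightarrow> 'a::field poly"
  assumes A: "A \<in> carrier_mat m m" and u: "u \<in> carrier_vec m"
    and inv: "invertible_mat (block_eval (tridiag_mat n lo di up) A)"
  defines "c \<equiv> \<lambda>i. - (lo i * up i)"
  shows "kron (mat_of_row (unit_vec (n + 1) 0)) (1\<^sub>m m) *\<^sub>v
      (mat_inv (block_eval (tridiag_mat n lo di up) A) *\<^sub>v
        kron_vec (unit_vec (n + 1) 0) (poly_mat (cf_num di c (Suc n)) A *\<^sub>v u))
    = poly_mat (cf_den di c (Suc n)) A *\<^sub>v u"
proof -
  let ?P = "tridiag_mat n lo di up"
  let ?p = "cf_num di c (Suc n)"
  let ?e = "unit_vec (n + 1) 0"
  obtain x where x: "x \<in> carrier_vec (n + 1)" "?P *\<^sub>v x = ?p \<cdot>\<^sub>v unit_vec (n + 1) 0"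
    "x $ 0 = cf_den di c (Suc n)"
    using tridiag_adjugate_column[of n lo di up] unfolding c_def by (simp only: Suc_eq_plus1) blast
  let ?X = "\<lambda>k. poly_mat (x $ k) A *\<^sub>v u"
  have P: "?P \<in> carrier_mat (n + 1) (n + 1)" by (simp add: tridiag_mat_def)
  note T = block_eval_carrier[OF P A]
  note C = poly_mat_vec_carrier[OF A u]
  have "block_eval ?P A *\<^sub>v stack (n + 1) m ?X
      = stack (n + 1) m (\<lambda>i. poly_mat ((?P *\<^sub>v x) $ i) A *\<^sub>v u)"
    by (rule block_eval_mult_stack[OF P A x(1) u])
  also have "\<dots> = kron_vec ?e (poly_mat ?p A *\<^sub>v u)"
  proof (rule eq_vecI)
    fix i assume "i < dim_vec (kron_vec ?e (poly_mat ?p A *\<^sub>v u))"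
    hence i: "i < (n + 1) * m" using C[of ?p] by (simp add: kron_vec_def del: dim_mult_mat_vec)
    note im = block_index_less[OF i]
    show "stack (n + 1) m (\<lambda>i. poly_mat ((?P *\<^sub>v x) $ i) A *\<^sub>v u) $ i
        = kron_vec ?e (poly_mat ?p A *\<^sub>v u) $ i"
      using i im C[of ?p] x(2) poly_mat_zero_vec[OF A u]
      by (cases "i div m = 0") (simp_all add: kron_vec_def stack_def del: dim_mult_mat_vec)
  qed (use C[of ?p] in \<open>simp add: kron_vec_def stack_def del: dim_mult_mat_vec\<close>)
  finally have sys: "block_eval ?P A *\<^sub>v stack (n + 1) m ?X = kron_vec ?e (poly_mat ?p A *\<^sub>v u)" .
  have "stack (n + 1) m ?X \<in> carrier_vec ((n + 1) * m)" by (simp add: stack_def)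
  from mat_inv_mult_vec[OF T inv this]
  have "mat_inv (block_eval ?P A) *\<^sub>v kron_vec ?e (poly_mat ?p A *\<^sub>v u) = stack (n + 1) m ?X"
    by (simp only: sys)
  thus ?thesis using kron_unit_row_mult_stack[of ?X m n] C x(3) by simp
qed

section \<open>Rational functions of a matrix\<close>

text \<open>
  Let \<open>q = f d\<close> and \<open>p = g d\<close> with \<open>f / g\<close> in lowest terms. Since \<open>p(A) = d(A) g(A)\<close>, injectivity of
  \<open>p(A)\<close> gives that of \<open>g(A)\<close>, and \<open>f(A) g(A)\<^sup>-\<^sup>1\<close> maps \<open>p(A) u = g(A) (d(A) u)\<close> to
  \<open>f(A) (d(A) u) = q(A) u\<close>.
\<close>

lemma ratfun_mat_fract:
  fixes A :: "complex mat"
  assumes A: "A \<in> carrier_mat m m" and u: "u \<in> carrier_vec m" and p: "p \<noteq> 0"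
    and inj: "\<And>w. w \<in> carrier_vec m \<Longrightarrow> poly_mat p A *\<^sub>v w = 0\<^sub>v m \<Longrightarrow> w = 0\<^sub>v m"
  shows "ratfun_mat_defined (Fract q p) A"
    and "ratfun_mat (Fract q p) A *\<^sub>v (poly_mat p A *\<^sub>v u) = poly_mat q A *\<^sub>v u"
proof -
  define f g where "f = fst (normalize_quot (q, p))" and "g = snd (normalize_quot (q, p))"
  obtain d where d: "q = f * d" "p = g * d" using normalize_quotE[OF p] unfolding f_def g_def by metis
  have quot: "quot_of_fract (Fract q p) = (f, g)"
    using quot_of_fract_quot_to_fract[of "(q, p)"] by (simp add: quot_to_fract_def f_def g_def)
  let ?G = "poly_mat g A"
  have G: "?G \<in> carrier_mat m m" by (rule poly_mat_carrier[OF A])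
  have F: "poly_mat f A \<in> carrier_mat m m" by (rule poly_mat_carrier[OF A])
  have inv: "invertible_mat ?G"
  proof (rule invertible_mat_if_trivial_kernel[OF G])
    fix w :: "complex vec" assume w: "w \<in> carrier_vec m" "?G *\<^sub>v w = 0\<^sub>v m"
    have "poly_mat (d * g) A *\<^sub>v w = 0\<^sub>v m"
      using poly_mat_mult_vec[OF A w(1), of d g] mult_mat_zero_vec[OF poly_mat_carrier[OF A, of d]] w(2)
      by simp
    thus "w = 0\<^sub>v m" using inj[OF w(1)] d(2) by (simp add: mult.commute)
  qed
  thus "ratfun_mat_defined (Fract q p) A" by (simp add: ratfun_mat_defined_def quot)
  let ?du = "poly_mat d A *\<^sub>v u"
  have du: "?du \<in> carrier_vec m" by (rule poly_mat_vec_carrier[OF A u])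
  have "?G *\<^sub>v ?du \<in> carrier_vec m" using G du by (rule mult_mat_vec_carrier)
  hence "ratfun_mat (Fract q p) A *\<^sub>v (poly_mat p A *\<^sub>v u)
      = poly_mat f A *\<^sub>v (mat_inv ?G *\<^sub>v (?G *\<^sub>v ?du))"
    unfolding ratfun_mat_def quot fst_conv snd_conv arg_cong[OF d(2), of "\<lambda>p. poly_mat p A *\<^sub>v u"]
      poly_mat_mult_vec[OF A u]
    by (intro assoc_mult_mat_vec[OF F mat_inv_inverts(1)[OF G inv]])
  also have "\<dots> = poly_mat q A *\<^sub>v u"
    unfolding mat_inv_mult_vec[OF G inv du] d(1) poly_mat_mult_vec[OF A u] ..
  finally show "ratfun_mat (Fract q p) A *\<^sub>v (poly_mat p A *\<^sub>v u) = poly_mat q A *\<^sub>v u" .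
qed

section \<open>Rational matrix functions from a CF-matrix\<close>

theorem theorem3p7:
  fixes b c \<alpha> \<beta> \<gamma> :: "nat \<Rightarrow> complex poly"
    and l n m :: nat
    and r :: "complex poly fract"
    and A :: "complex mat"
    and v :: "complex vec"
  assumes deg_b: "\<And>i. degree (b i) \<le> l"
    and deg_c: "\<And>i. 1 \<le> i \<Longrightarrow> degree (c i) \<le> l"
    and c_nonzero: "\<And>i. 1 \<le> i \<Longrightarrow> i \<le> n \<Longrightarrow> c i \<noteq> 0"
    and r: "r = inverse (cf_approximant b c n)"
    and deg_\<alpha>: "\<And>i. 1 \<le> i \<Longrightarrow> i \<le> n \<Longrightarrow> degree (\<alpha> i) \<le> l"
    and deg_\<beta>: "\<And>i. i \<le> n \<Longrightarrow> degree (\<beta> i) \<le> l"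
    and deg_\<gamma>: "\<And>i. 1 \<le> i \<Longrightarrow> i \<le> n \<Longrightarrow> degree (\<gamma> i) \<le> l"
    and \<beta>_eq: "\<And>i. i \<le> n \<Longrightarrow> \<beta> i = b i"
    and \<alpha>\<gamma>_eq: "\<And>i. 1 \<le> i \<Longrightarrow> i \<le> n \<Longrightarrow> - (\<alpha> i * \<gamma> i) = c i"
    and A: "A \<in> carrier_mat m m"
    and nonsingular: "invertible_mat (cf_matrix l n \<alpha> \<beta> \<gamma> A)"
    and v: "v \<in> carrier_vec m"
  shows "ratfun_mat_defined r A \<and>
    ratfun_mat r A *\<^sub>v v =
      kron (mat_of_row (unit_vec (n + 1) 0)) (1\<^sub>m m) *\<^sub>v
        (mat_inv (cf_matrix l n \<alpha> \<beta> \<gamma> A) *\<^sub>v kron_vec (unit_vec (n + 1) 0) v)"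
proof (cases "m = 0")
  case True
  \<comment> \<open>Here \<open>p\<^sub>n\<close> may vanish, but all matrices and vectors involved are empty.\<close>
  have "invertible_mat (poly_mat (snd (quot_of_fract r)) A)"
    using poly_mat_carrier[OF A] True
    by (intro invertible_mat_if_trivial_kernel[of _ 0]) auto
  moreover have "ratfun_mat r A *\<^sub>v v
      = kron (mat_of_row (unit_vec (n + 1) 0)) (1\<^sub>m m) *\<^sub>v
          (mat_inv (cf_matrix l n \<alpha> \<beta> \<gamma> A) *\<^sub>v kron_vec (unit_vec (n + 1) 0) v)"
    using A True by (intro eq_vecI) (auto simp: ratfun_mat_def kron_def poly_mat_def matsum_def)
  ultimately show ?thesis by (simp add: ratfun_mat_defined_def)
next
  case False
  define p q where "p = cf_num b c (Suc n)" and "q = cf_den b c (Suc n)"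
  have p: "p = cf_num \<beta> (\<lambda>i. - (\<alpha> i * \<gamma> i)) (Suc n)"
    unfolding p_def using \<beta>_eq \<alpha>\<gamma>_eq by (intro cf_num_cong) auto
  have q: "q = cf_den \<beta> (\<lambda>i. - (\<alpha> i * \<gamma> i)) (Suc n)"
    unfolding q_def using \<beta>_eq \<alpha>\<gamma>_eq by (intro cf_den_cong) auto
  have rqp: "r = Fract q p" by (simp add: r cf_approximant_def p_def q_def)
  let ?P = "tridiag_mat n \<alpha> \<beta> \<gamma>"
  have P: "?P \<in> carrier_mat (n + 1) (n + 1)" by (simp add: tridiag_mat_def)
  have T: "cf_matrix l n \<alpha> \<beta> \<gamma> A = block_eval ?P A"
    by (rule cf_matrix_eq_block_eval[OF A deg_\<alpha> deg_\<beta> deg_\<gamma>])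
  have inj: "w = 0\<^sub>v m" if "w \<in> carrier_vec m" "poly_mat p A *\<^sub>v w = 0\<^sub>v m" for w
    using block_eval_invertible_imp_det_injective[OF P A nonsingular[unfolded T] that(1)] that(2)
    by (simp only: det_tridiag_mat p)
  have "p \<noteq> 0"
  proof
    assume "p = 0"
    have "unit_vec m 0 = (0\<^sub>v m :: complex vec)"
      by (rule inj) (use \<open>p = 0\<close> in \<open>auto simp: poly_mat_zero_vec[OF A]\<close>)
    with False show False by simp
  qed
  have pA: "poly_mat p A \<in> carrier_mat m m" by (rule poly_mat_carrier[OF A])
  have inv: "invertible_mat (poly_mat p A)"
    by (rule invertible_mat_if_trivial_kernel[OF pA inj])
  define u where "u = mat_inv (poly_mat p A) *\<^sub>v v"
  note I = mat_inv_inverts[OF pA inv]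
  have u: "u \<in> carrier_vec m" unfolding u_def using I(1) v by (rule mult_mat_vec_carrier)
  have pu: "poly_mat p A *\<^sub>v u = v"
    unfolding u_def using assoc_mult_mat_vec[OF pA I(1) v] I(3) v by simp
  show ?thesis
    using ratfun_mat_fract[OF A u \<open>p \<noteq> 0\<close> inj, of q] nonsingular
      block_system_solution[OF A u, of n \<alpha> \<beta> \<gamma>]
    by (simp add: T rqp pu p[symmetric] q[symmetric])
qed

end
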